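(* Let $p\in[1,\infty)\cup\{\infty\}$ and let $P\subseteq\mathbb{R}^d$ be a finite set of points. There exists a point $c\in\mathbb{R}^d$ such that $|\mathcal{H}^p_{c,v}\cap P|\ge\frac{|P|}{d+1}$ for all $v\in S^{d-1}$.
   Context: For $x\in\mathbb{R}^d$ and $v\in\mathbb{R}^d\setminus\{0\}$, the (limit) $\ell_p$-halfspace is $\mathcal{H}^p_{x,v}=\{z\in\mathbb{R}^d : \|x-z\|_p\le\|x-\epsilon v-z\|_p \text{ for all }\epsilon>0\}$, where $\|\cdot\|_p$ is the $\ell_p$-norm ($\|y\|_\infty=\max_i|y_i|$). $S^{d-1}$ is the Euclidean unit sphere. *)

theory Defs
  imports "HOL-Analysis.Analysis"
begin

definition lp_norm :: "ereal \<Rightarrow> real ^ 'n \<Rightarrow> real" where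
  "lp_norm p y =
     (if p = \<infinity> then infnorm y
      else (\<Sum>i\<in>UNIV. \<bar>y $ i\<bar> powr real_of_ereal p) powr (1 / real_of_ereal p))"

definition lp_halfspace :: "ereal \<Rightarrow> real ^ 'n \<Rightarrow> real ^ 'n \<Rightarrow> (real ^ 'n) set" where
  "lp_halfspace p x v = {z. \<forall>\<epsilon>>0. lp_norm p (x - z) \<le> lp_norm p (x - \<epsilon> *\<^sub>R v - z)}"

end

theory Submission
  imports Defs
begin

text \<open>
  Only convexity and coercivity of the norm matter. Fix a point \<open>c\<close> and call \<open>v\<close> an improving
  direction for \<open>z\<close> if moving from \<open>c\<close> along \<open>-v\<close> brings us strictly closer to \<open>z\<close>; that is,
  \<open>z\<close> lies outside the halfspace at \<open>c\<close> in direction \<open>v\<close>. Improving directions form a convex set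
  not containing \<open>0\<close>, and improvement is an open condition in \<open>c\<close>. If no \<open>c\<close> is a centerpoint,
  then every \<open>c\<close> has a direction that improves all but fewer than \<open>|P|/(d+1)\<close> points, and these
  directions can be glued to a continuous field \<open>w\<close> on a large ball such that \<open>w c\<close> is a convex
  combination of such directions at \<open>c\<close>. By Caratheodory, \<open>d + 1\<close> of them suffice, so
  some \<open>z \<in> P\<close> is improved by all of these and hence by \<open>w c\<close>. Brouwer's theorem yields a point
  where \<open>- w c\<close> is a nonnegative multiple of \<open>c\<close>, vanishing unless \<open>c\<close> is on the boundary of the
  ball. But moving a far away point \<open>c\<close> further out cannot bring it closer to \<open>z\<close>.
\<close>

section \<open>Improving directions of a convex function\<close>

definition improving :: "('a::real_vector \<Rightarrow> real) \<Rightarrow> 'a \<Rightarrow> 'a set" where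
  "improving N x = {v. \<exists>\<epsilon>>0. N (x - \<epsilon> *\<^sub>R v) < N x}"

lemma zero_notin_improving: "0 \<notin> improving N x"
  by (simp add: improving_def)

text \<open>The point at step \<open>d\<close> lies on the segment from \<open>x\<close> to the
  strictly lower point at step \<open>e\<close>. This lets several directions share one step
  length.\<close>

lemma convex_on_less_shrink:
  fixes x v :: "'a::real_vector"
  assumes "convex_on UNIV N" and "N (x - e *\<^sub>R v) < N x" and "0 < d" and "d \<le> e"
  shows "N (x - d *\<^sub>R v) < N x"
proof -
  let ?t = "d / e"
  have t: "0 < ?t" "?t \<le> 1" using assms(3,4) by auto
  have "x - d *\<^sub>R v = (1 - ?t) *\<^sub>R x + ?t *\<^sub>R (x - e *\<^sub>R v)"
    using assms(3,4) by (simp add: algebra_simps)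
  then have "N (x - d *\<^sub>R v) \<le> (1 - ?t) * N x + ?t * N (x - e *\<^sub>R v)"
    using convex_onD[OF assms(1), of ?t x "x - e *\<^sub>R v"] t by simp
  also have "\<dots> < (1 - ?t) * N x + ?t * N x"
    using t(1) assms(2) by (intro add_strict_left_mono mult_strict_left_mono)
  finally show ?thesis by (simp add: algebra_simps)
qed

text \<open>With a common step length, the point reached along a convex combination of directions is
  the same convex combination of two points strictly below level \<open>N x\<close>.\<close>

lemma convex_improving:
  assumes "convex_on UNIV N"
  shows "convex (improving N x)"
proof (rule convexI)
  fix u v :: 'a and a b :: real
  assume "u \<in> improving N x" "v \<in> improving N x" and ab: "0 \<le> a" "0 \<le> b" "a + b = 1"
  then obtain e f where e: "e > 0" "N (x - e *\<^sub>R u) < N x" and f: "f > 0" "N (x - f *\<^sub>R v) < N x"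
    by (auto simp: improving_def)
  define d where "d = min e f"
  have d: "d > 0" "d \<le> e" "d \<le> f" using e f by (auto simp: d_def)
  have u: "N (x - d *\<^sub>R u) < N x" and v: "N (x - d *\<^sub>R v) < N x"
    using convex_on_less_shrink[OF assms] e f d by blast+
  have "x - d *\<^sub>R (a *\<^sub>R u + b *\<^sub>R v) = (a + b) *\<^sub>R x - d *\<^sub>R (a *\<^sub>R u + b *\<^sub>R v)"
    using ab by simp
  also have "\<dots> = a *\<^sub>R (x - d *\<^sub>R u) + b *\<^sub>R (x - d *\<^sub>R v)"
    by (simp add: algebra_simps)
  finally have "N (x - d *\<^sub>R (a *\<^sub>R u + b *\<^sub>R v)) \<le> a * N (x - d *\<^sub>R u) + b * N (x - d *\<^sub>R v)"
    using assms ab by (simp add: convex_on_def)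
  also have "\<dots> < N x"
    using convex_bound_lt[OF u v] ab by simp
  finally show "a *\<^sub>R u + b *\<^sub>R v \<in> improving N x"
    using d by (auto simp: improving_def)
qed

lemma open_improving:
  fixes N :: "'a::real_normed_vector \<Rightarrow> real"
  assumes "continuous_on UNIV N"
  shows "open {x. v \<in> improving N (x - z)}"
proof -
  have "{x. v \<in> improving N (x - z)} = (\<Union>\<epsilon>\<in>{0<..}. {x. N (x - z - \<epsilon> *\<^sub>R v) < N (x - z)})"
    by (auto simp: improving_def)
  moreover have "open {x. N (x - z - \<epsilon> *\<^sub>R v) < N (x - z)}" for \<epsilon>
    by (intro open_Collect_less continuous_on_compose2[OF assms] continuous_intros) auto
  ultimately show ?thesis by auto
qed

text \<open>The finitely many improvements by \<open>v\<close> that hold at \<open>x\<close> all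
  persist nearby, so the number of points not improved cannot grow near \<open>x\<close>.\<close>

lemma open_many_improved:
  fixes N :: "'a::real_normed_vector \<Rightarrow> real"
  assumes "continuous_on UNIV N" and "finite P"
  shows "open {x. real (card {z \<in> P. v \<notin> improving N (x - z)}) < m}"
proof (subst open_subopen, rule ballI)
  fix x assume "x \<in> {x. real (card {z \<in> P. v \<notin> improving N (x - z)}) < m}"
  then have m: "real (card {z \<in> P. v \<notin> improving N (x - z)}) < m" by simp
  let ?T = "\<Inter>z\<in>{z \<in> P. v \<in> improving N (x - z)}. {y. v \<in> improving N (y - z)}"
  have "open ?T"
    using assms by (intro open_INT ballI open_improving) auto
  moreover have "x \<in> ?T" by auto
  moreover have "?T \<subseteq> {y. real (card {z \<in> P. v \<notin> improving N (y - z)}) < m}"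
  proof
    fix y assume "y \<in> ?T"
    then have "{z \<in> P. v \<notin> improving N (y - z)} \<subseteq> {z \<in> P. v \<notin> improving N (x - z)}" by auto
    then have "card {z \<in> P. v \<notin> improving N (y - z)} \<le> card {z \<in> P. v \<notin> improving N (x - z)}"
      using assms(2) by (intro card_mono) auto
    then show "y \<in> {y. real (card {z \<in> P. v \<notin> improving N (y - z)}) < m}" using m by simp
  qed
  ultimately show "\<exists>T. open T \<and> x \<in> T \<and> T \<subseteq> {y. real (card {z \<in> P. v \<notin> improving N (y - z)}) < m}"
    by blast
qed

text \<open>At most d + 1 directions are involved, and each fails on fewer than |P|/(d+1) points, so
  their failures cannot exhaust \<open>P\<close>. A point improved by all of them is improved by
  their convex hull.\<close>

lemma caratheodory_improves_common_point:
  fixes N :: "'a::euclidean_space \<Rightarrow> real"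
  assumes "convex_on UNIV N" and "finite P"
    and few: "\<And>v. v \<in> V \<Longrightarrow>
      real (card {z \<in> P. v \<notin> improving N (x - z)}) < real (card P) / (real DIM('a) + 1)"
    and "w \<in> convex hull V"
  obtains z where "z \<in> P" and "w \<in> improving N (x - z)"
proof -
  obtain S where S: "finite S" "S \<subseteq> V" "card S \<le> DIM('a) + 1" "w \<in> convex hull S"
    using assms(4) caratheodory[of V] by auto
  let ?B = "\<lambda>v. {z \<in> P. v \<notin> improving N (x - z)}"
  have "S \<noteq> {}" using S(4) by auto
  have "real (card (\<Union>v\<in>S. ?B v)) \<le> (\<Sum>v\<in>S. real (card (?B v)))"
    using card_UN_le[OF S(1), of ?B] by (simp flip: of_nat_sum)
  also have "\<dots> < (\<Sum>v\<in>S. real (card P) / (real DIM('a) + 1))"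
    using S few \<open>S \<noteq> {}\<close> by (intro sum_strict_mono) auto
  also have "\<dots> = real (card S) * (real (card P) / (real DIM('a) + 1))" by simp
  also have "\<dots> \<le> (real DIM('a) + 1) * (real (card P) / (real DIM('a) + 1))"
    using S(3) by (intro mult_right_mono) auto
  also have "\<dots> = real (card P)" by (simp add: add_nonneg_eq_0_iff del: of_nat_Suc)
  finally have "(\<Union>v\<in>S. ?B v) \<noteq> P" by auto
  then obtain z where z: "z \<in> P" "S \<subseteq> improving N (x - z)" by auto
  then have "convex hull S \<subseteq> improving N (x - z)"
    by (intro hull_minimal convex_improving assms)
  then show ?thesis using that z S(4) by auto
qed

section \<open>Centerpoints for coercive convex functions\<close>

lemma open_continuous_support:
  fixes U :: "'a::euclidean_space set"
  assumes "open U"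
  obtains \<phi> :: "'a \<Rightarrow> real"
  where "continuous_on UNIV \<phi>" and "\<And>x. 0 \<le> \<phi> x" and "\<And>x. 0 < \<phi> x \<longleftrightarrow> x \<in> U"
\<comment> \<open>\<open>setdist\<close> to the empty set is 0, so the distance to the complement
  detects membership only when \<open>U\<close> is not the whole space.\<close>
proof (cases "U = UNIV")
  case True
  then show ?thesis using that[of "\<lambda>_. 1"] by auto
next
  case False
  show ?thesis
  proof (rule that[of "\<lambda>x. setdist {x} (- U)"])
    show "0 < setdist {x} (- U) \<longleftrightarrow> x \<in> U" for x
      using False assms setdist_eq_0_sing_1[of x "- U"] setdist_pos_le[of "{x}" "- U"]
      by (auto simp: less_le closed_open)
  qed (auto intro: continuous_on_setdist)
qed

lemma radial_zero_on_cball: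
  fixes w :: "'a::euclidean_space \<Rightarrow> 'a"
  assumes "0 < R" and "continuous_on (cball 0 R) w"
  obtains c \<mu> where "norm c \<le> R" "1 \<le> \<mu>" "c - w c = \<mu> *\<^sub>R c" "norm c = R \<or> w c = 0"
proof -
  \<comment> \<open>This is the radial retraction of \<open>c - w c\<close> onto the ball. At a
    fixed point the scaling factor inverts to \<open>\<mu>\<close>, and scaling occurs only if the
    image is on the sphere.\<close>
  define g where "g c = (R / max R (norm (c - w c))) *\<^sub>R (c - w c)" for c
  have cont: "continuous_on (cball 0 R) g"
    unfolding g_def using assms by (intro continuous_intros) (auto simp: max_def)
  have norm_g: "norm (g c) = R / max R (norm (c - w c)) * norm (c - w c)" for c
    using assms(1) by (simp add: g_def)
  have maps: "g \<in> cball 0 R \<rightarrow> cball 0 R"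
    using assms(1) by (auto simp: norm_g max_def field_simps)
  obtain c where c: "c \<in> cball 0 R" "g c = c"
    using brouwer[OF compact_cball convex_cball _ cont maps] assms(1) by auto
  define \<mu> where "\<mu> = max R (norm (c - w c)) / R"
  have \<mu>: "1 \<le> \<mu>" using assms(1) by (simp add: \<mu>_def)
  have "\<mu> *\<^sub>R g c = c - w c"
    using assms(1) by (simp add: \<mu>_def g_def max_def)
  then have eq: "c - w c = \<mu> *\<^sub>R c" using c by simp
  have "norm c = R \<or> w c = 0"
  proof (cases "norm (c - w c) \<le> R")
    case True
    then have "\<mu> = 1" using assms(1) by (simp add: \<mu>_def max_def)
    then show ?thesis using eq by simp
  next
    case False
    then have "norm (g c) = R" unfolding norm_g using assms(1) by (auto simp: max_def)
    then show ?thesis using c by simp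
  qed
  then show ?thesis using that c \<mu> eq by auto
qed

text \<open>The point \<open>c - z\<close> lies on the segment from \<open>- z\<close> to any point
  reached by moving further out along \<open>c\<close>. A strictly lower value at the outer end
  would contradict convexity, as \<open>- z\<close> is not higher than \<open>c - z\<close>.\<close>

lemma not_improving_outward:
  assumes "convex_on UNIV N" and "N (- z) \<le> N (c - z)" and "0 \<le> t"
  shows "- (t *\<^sub>R c) \<notin> improving N (c - z)"
proof
  assume "- (t *\<^sub>R c) \<in> improving N (c - z)"
  then obtain e where e: "e > 0" "N (c - z + (e * t) *\<^sub>R c) < N (c - z)"
    by (auto simp: improving_def)
  \<comment> \<open>This weight makes the coefficient of \<open>c\<close> in the convex combination
    equal to 1.\<close>
  define s where "s = 1 / (1 + e * t)"
  have s: "0 < s" "s \<le> 1" "s * (1 + e * t) = 1"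
    using e assms(3) by (auto simp: s_def add_pos_nonneg field_simps add_nonneg_eq_0_iff)
  have "(1 - s) *\<^sub>R (- z) + s *\<^sub>R (c - z + (e * t) *\<^sub>R c) = (s * (1 + e * t)) *\<^sub>R c - z"
    by (simp add: algebra_simps)
  then have "N (c - z) \<le> (1 - s) * N (- z) + s * N (c - z + (e * t) *\<^sub>R c)"
    using convex_onD[OF assms(1), of s "- z" "c - z + (e * t) *\<^sub>R c"] s by simp
  also have "\<dots> < (1 - s) * N (c - z) + s * N (c - z)"
    using s e assms(2) by (intro add_le_less_mono mult_left_mono mult_strict_left_mono) auto
  finally show False by (simp add: algebra_simps)
qed

theorem centerpoint_coercive_convex:
  fixes N :: "'a::euclidean_space \<Rightarrow> real"
  assumes conv: "convex_on UNIV N" and coercive: "filterlim N at_top at_infinity"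
    and fin: "finite P"
  shows "\<exists>c. \<forall>v. real (card P) / (real DIM('a) + 1) \<le> real (card {z \<in> P. v \<notin> improving N (c - z)})"
proof (rule ccontr)
  assume "\<not> ?thesis"
  then have bad: "\<exists>v. real (card {z \<in> P. v \<notin> improving N (c - z)}) < real (card P) / (real DIM('a) + 1)" for c
    by (meson not_le)
  have cont: "continuous_on UNIV N"
    using convex_on_continuous[OF open_UNIV conv] .
  define U where
    "U v = {c. real (card {z \<in> P. v \<notin> improving N (c - z)}) < real (card P) / (real DIM('a) + 1)}" for v
  have opU: "open (U v)" for v
    unfolding U_def by (rule open_many_improved[OF cont fin])

  obtain R where R: "R > 0" "\<And>c z. norm c = R \<Longrightarrow> z \<in> P \<Longrightarrow> N (- z) \<le> N (c - z)"
  proof -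
    have "\<forall>\<^sub>F y in at_infinity. \<forall>z\<in>P. N (- z) \<le> N y"
      using fin coercive by (auto simp: eventually_ball_finite_distrib filterlim_at_top)
    then obtain b where b: "b > 0" "\<And>y z. b \<le> norm y \<Longrightarrow> z \<in> P \<Longrightarrow> N (- z) \<le> N y"
      by (auto simp: eventually_at_infinity_pos)
    show ?thesis
    \<comment> \<open>The sum bounds every \<open>norm z\<close>, so on this sphere
      \<open>c - z\<close> has norm at least \<open>b\<close>.\<close>
    proof (rule that[of "b + (\<Sum>z\<in>P. norm z)"])
      show "b + (\<Sum>z\<in>P. norm z) > 0" using b(1) by (simp add: add_pos_nonneg sum_nonneg)
      fix c z :: 'a assume c: "norm c = b + (\<Sum>z\<in>P. norm z)" and z: "z \<in> P"
      have "norm z \<le> (\<Sum>z\<in>P. norm z)" using fin z by (intro member_le_sum) auto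
      then have "b \<le> norm (c - z)" using c norm_triangle_ineq2[of c z] by linarith
      then show "N (- z) \<le> N (c - z)" using b z by auto
    qed
  qed

  have "cball 0 R \<subseteq> (\<Union>v\<in>UNIV. U v)" using bad by (auto simp: U_def)
  then obtain V where V: "finite V" "cball 0 R \<subseteq> (\<Union>v\<in>V. U v)"
    using compactE_image[OF compact_cball, of UNIV U 0 R] opU by metis
  have "\<exists>\<phi>::'a \<Rightarrow> real. continuous_on UNIV \<phi> \<and> (\<forall>x. 0 \<le> \<phi> x) \<and> (\<forall>x. 0 < \<phi> x \<longleftrightarrow> x \<in> U v)" for v
    by (rule open_continuous_support[OF opU[of v]]) auto
  then obtain \<phi> :: "'a \<Rightarrow> 'a \<Rightarrow> real" where \<phi>: "\<And>v. continuous_on UNIV (\<phi> v)"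
      "\<And>v x. 0 \<le> \<phi> v x" "\<And>v x. 0 < \<phi> v x \<longleftrightarrow> x \<in> U v"
    by metis
  define s where "s c = (\<Sum>v\<in>V. \<phi> v c)" for c
  \<comment> \<open>The quotients form a partition of unity on the ball, where \<open>s\<close> is
    positive because the sets \<open>U v\<close> with \<open>v\<close> in \<open>V\<close> cover
    it.\<close>
  define w where "w c = (\<Sum>v\<in>V. (\<phi> v c / s c) *\<^sub>R v)" for c
  have s_pos: "s c > 0" if c: "c \<in> cball 0 R" for c
  proof -
    obtain v where "v \<in> V" "c \<in> U v" using V(2) c by blast
    then show ?thesis unfolding s_def using V(1) \<phi> by (intro sum_pos2[of V v]) auto
  qed
  have cont_\<phi>: "continuous_on (cball 0 R) (\<phi> v)" for v
    using \<phi>(1) continuous_on_subset by blast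
  have "continuous_on (cball 0 R) s"
    unfolding s_def by (intro continuous_intros cont_\<phi>)
  then have "continuous_on (cball 0 R) w"
    unfolding w_def using s_pos by (intro continuous_intros cont_\<phi>) force+
  then obtain c \<mu> where c: "norm c \<le> R" "1 \<le> \<mu>" "c - w c = \<mu> *\<^sub>R c" "norm c = R \<or> w c = 0"
    by (rule radial_zero_on_cball[OF R(1)])
  have sc: "s c > 0" using s_pos c(1) by simp

  \<comment> \<open>Terms of weight zero are dropped, so that only directions that are good at
    \<open>c\<close> itself remain.\<close>
  have "w c = (\<Sum>v\<in>{v \<in> V. c \<in> U v}. (\<phi> v c / s c) *\<^sub>R v)"
    unfolding w_def using V(1) \<phi>(2,3)[of _ c]
    by (intro sum.mono_neutral_right) (auto simp: less_le)
  moreover have "(\<Sum>v\<in>{v \<in> V. c \<in> U v}. \<phi> v c / s c) = (\<Sum>v\<in>V. \<phi> v c / s c)"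
    using V(1) \<phi>(2,3)[of _ c] by (intro sum.mono_neutral_left) (auto simp: less_le)
  moreover have "(\<Sum>v\<in>V. \<phi> v c / s c) = 1"
    using sc by (simp add: s_def flip: sum_divide_distrib)
  ultimately have "w c \<in> convex hull {v \<in> V. c \<in> U v}"
    using V(1) \<phi>(2) sc
    by (auto simp: convex_hull_finite intro!: exI[of _ "\<lambda>v. \<phi> v c / s c"])
  then obtain z where z: "z \<in> P" "w c \<in> improving N (c - z)"
    by (rule caratheodory_improves_common_point[OF conv fin, rotated]) (auto simp: U_def)
  \<comment> \<open>Hence \<open>c\<close> is on the sphere, where moving along \<open>- w c\<close>
    goes outward or nowhere.\<close>
  have "w c \<noteq> 0" using z(2) zero_notin_improving by metis
  then have "N (- z) \<le> N (c - z)" using c(4) R(2) z(1) by blast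
  then have "- ((\<mu> - 1) *\<^sub>R c) \<notin> improving N (c - z)"
    using c(2) by (intro not_improving_outward[OF conv]) auto
  moreover have "w c = - ((\<mu> - 1) *\<^sub>R c)" using c(3) by (simp add: algebra_simps)
  ultimately show False using z(2) by simp
qed

section \<open>Powers of the \<open>\<ell>\<^sub>p\<close>-norm\<close>

lemma convex_on_infnorm: "convex_on UNIV (infnorm :: 'a::euclidean_space \<Rightarrow> real)"
proof (rule convex_onI)
  fix t :: real and x y :: 'a
  assume "0 < t" "t < 1"
  then show "infnorm ((1 - t) *\<^sub>R x + t *\<^sub>R y) \<le> (1 - t) * infnorm x + t * infnorm y"
    using infnorm_triangle[of "(1 - t) *\<^sub>R x" "t *\<^sub>R y"] by (simp add: infnorm_mul)
qed simp

lemma filterlim_infnorm_at_top: "filterlim (infnorm :: 'a::euclidean_space \<Rightarrow> real) at_top at_infinity"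
proof (rule filterlim_at_top_mono)
  show "filterlim (\<lambda>x::'a. inverse (sqrt DIM('a)) * norm x) at_top at_infinity"
    by (intro filterlim_tendsto_pos_mult_at_top[OF tendsto_const] filterlim_norm_at_top) simp
  show "\<forall>\<^sub>F x::'a in at_infinity. inverse (sqrt DIM('a)) * norm x \<le> infnorm x"
    using norm_le_infnorm by (intro always_eventually) (auto simp: field_simps)
qed

lemma convex_on_powr_nonneg:
  fixes q :: real
  assumes "1 \<le> q"
  shows "convex_on {0..} (\<lambda>x. x powr q)"
proof (rule convex_on_linorderI)
  fix t x y :: real
  assume t: "0 < t" "t < 1" and xy: "x \<in> {0..}" "y \<in> {0..}" "x < y"
  show "((1 - t) *\<^sub>R x + t *\<^sub>R y) powr q \<le> (1 - t) * x powr q + t * y powr q"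
  \<comment> \<open>Since \<open>x < y\<close>, only \<open>x\<close> can be the endpoint 0; the
    claim then reduces to \<open>t powr q \<le> t\<close>.\<close>
  proof (cases "x = 0")
    case True
    have "t powr q \<le> t powr 1" using t assms by (intro powr_mono') auto
    then show ?thesis using True t xy by (simp add: powr_mult mult_right_mono)
  next
    case False
    then show ?thesis using convex_onD[OF powr_convex[OF assms], of t x y] t xy by simp
  qed
qed simp

lemma convex_on_abs_powr:
  fixes q :: real
  assumes "1 \<le> q"
  shows "convex_on UNIV (\<lambda>x::real. \<bar>x\<bar> powr q)"
proof (rule convex_onI)
  fix t x y :: real
  assume t: "0 < t" "t < 1"
  have "\<bar>(1 - t) * x + t * y\<bar> \<le> (1 - t) * \<bar>x\<bar> + t * \<bar>y\<bar>"
    using t abs_triangle_ineq[of "(1 - t) * x" "t * y"] by (simp add: abs_mult)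
  then have "\<bar>(1 - t) * x + t * y\<bar> powr q \<le> ((1 - t) * \<bar>x\<bar> + t * \<bar>y\<bar>) powr q"
    using assms by (intro powr_mono2) auto
  also have "\<dots> \<le> (1 - t) * \<bar>x\<bar> powr q + t * \<bar>y\<bar> powr q"
    using convex_onD[OF convex_on_powr_nonneg[OF assms], of t "\<bar>x\<bar>" "\<bar>y\<bar>"] t by simp
  finally show "\<bar>(1 - t) *\<^sub>R x + t *\<^sub>R y\<bar> powr q \<le> (1 - t) * \<bar>x\<bar> powr q + t * \<bar>y\<bar> powr q"
    by simp
qed simp

lemma convex_on_sum_abs_powr:
  fixes q :: real
  assumes "1 \<le> q"
  shows "convex_on UNIV (\<lambda>y::real^'n. \<Sum>i\<in>UNIV. \<bar>y $ i\<bar> powr q)"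
proof (rule convex_onI)
  fix t :: real and x y :: "real^'n"
  assume t: "0 < t" "t < 1"
  have "(\<Sum>i\<in>UNIV. \<bar>((1 - t) *\<^sub>R x + t *\<^sub>R y) $ i\<bar> powr q)
      \<le> (\<Sum>i\<in>UNIV. (1 - t) * \<bar>x $ i\<bar> powr q + t * \<bar>y $ i\<bar> powr q)"
    using convex_onD[OF convex_on_abs_powr[OF assms], of t] t by (intro sum_mono) simp
  then show "(\<Sum>i\<in>UNIV. \<bar>((1 - t) *\<^sub>R x + t *\<^sub>R y) $ i\<bar> powr q)
      \<le> (1 - t) * (\<Sum>i\<in>UNIV. \<bar>x $ i\<bar> powr q) + t * (\<Sum>i\<in>UNIV. \<bar>y $ i\<bar> powr q)"
    by (simp add: sum.distrib sum_distrib_left)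
qed simp

text \<open>A coordinate of absolute value at most 1 is absorbed by the summand 1; a larger one is
  at most its own \<open>q\<close>-th power.\<close>

lemma infnorm_le_sum_abs_powr:
  fixes y :: "real^'n" and q :: real
  assumes "1 \<le> q"
  shows "infnorm y \<le> 1 + (\<Sum>i\<in>UNIV. \<bar>y $ i\<bar> powr q)"
proof -
  have "\<bar>y $ i\<bar> \<le> 1 + (\<Sum>i\<in>UNIV. \<bar>y $ i\<bar> powr q)" for i
  proof -
    have "\<bar>y $ i\<bar> \<le> 1 + \<bar>y $ i\<bar> powr q"
    proof (cases "\<bar>y $ i\<bar> \<le> 1")
      case True
      then show ?thesis by (simp add: add_increasing2)
    next
      case False
      then have "\<bar>y $ i\<bar> powr 1 \<le> \<bar>y $ i\<bar> powr q" using assms by (intro powr_mono) auto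
      then show ?thesis by simp
    qed
    also have "\<bar>y $ i\<bar> powr q \<le> (\<Sum>i\<in>UNIV. \<bar>y $ i\<bar> powr q)"
      by (rule member_le_sum) auto
    finally show ?thesis by simp
  qed
  then show ?thesis
    by (auto simp: infnorm_Max Basis_vec_def inner_axis)
qed

lemma filterlim_sum_abs_powr_at_top:
  fixes q :: real
  assumes "1 \<le> q"
  shows "filterlim (\<lambda>y::real^'n. \<Sum>i\<in>UNIV. \<bar>y $ i\<bar> powr q) at_top at_infinity"
proof (rule filterlim_at_top_mono)
  show "filterlim (\<lambda>y::real^'n. - 1 + infnorm y) at_top at_infinity"
    by (intro filterlim_tendsto_add_at_top[OF tendsto_const] filterlim_infnorm_at_top)
  show "\<forall>\<^sub>F y::real^'n in at_infinity. - 1 + infnorm y \<le> (\<Sum>i\<in>UNIV. \<bar>y $ i\<bar> powr q)"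
    using infnorm_le_sum_abs_powr[OF assms] by (intro always_eventually allI) (simp add: algebra_simps)
qed

text \<open>Halfspaces only compare norms, so an increasing transform of the norm serves as well.
  For finite \<open>p\<close> the \<open>p\<close>-th power is convex coordinate by coordinate,
  which avoids Minkowski's inequality.\<close>

lemma lp_norm_order_equiv_coercive_convex:
  fixes p :: ereal
  assumes "1 \<le> p"
  obtains N :: "real^'n \<Rightarrow> real"
  where "convex_on UNIV N" "filterlim N at_top at_infinity" "\<And>x y. lp_norm p x \<le> lp_norm p y \<longleftrightarrow> N x \<le> N y"
proof (cases "p = \<infinity>")
  case True
  then show ?thesis
    using that[of infnorm] convex_on_infnorm filterlim_infnorm_at_top by (simp add: lp_norm_def)
next
  case False
  with assms obtain q where q: "p = ereal q" "1 \<le> q"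
    by (cases p) auto
  have "lp_norm p x \<le> lp_norm p y \<longleftrightarrow>
      (\<Sum>i\<in>UNIV. \<bar>x $ i\<bar> powr q) \<le> (\<Sum>i\<in>UNIV. \<bar>y $ i\<bar> powr q)" for x y :: "real^'n"
  proof -
    have "0 \<le> (\<Sum>i\<in>UNIV. \<bar>x $ i\<bar> powr q)" "0 \<le> (\<Sum>i\<in>UNIV. \<bar>y $ i\<bar> powr q)"
      by (simp_all add: sum_nonneg)
    moreover have "a powr (1 / q) \<le> b powr (1 / q) \<longleftrightarrow> a \<le> b" if "0 \<le> a" "0 \<le> b" for a b :: real
      using that q(2) powr_mono2[of "1 / q" a b] powr_less_mono2[of "1 / q" b a] by force
    ultimately show ?thesis using q by (simp add: lp_norm_def)
  qed
  then show ?thesis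
    using that convex_on_sum_abs_powr[OF q(2)] filterlim_sum_abs_powr_at_top[OF q(2)] by blast
qed

theorem theorem3p18:
  fixes p :: ereal and P :: "(real ^ 'n) set"
  assumes "1 \<le> p" and "finite P"
  shows "\<exists>c :: real ^ 'n. \<forall>v \<in> sphere 0 1.
           real (card (lp_halfspace p c v \<inter> P)) \<ge> real (card P) / (real CARD('n) + 1)"
proof -
  obtain N :: "real^'n \<Rightarrow> real" where N: "convex_on UNIV N" "filterlim N at_top at_infinity"
    "\<And>x y. lp_norm p x \<le> lp_norm p y \<longleftrightarrow> N x \<le> N y"
    using lp_norm_order_equiv_coercive_convex[OF assms(1)] by blast
  \<comment> \<open>Lying in the halfspace is exactly the negation of being improved, once norms are
    compared through \<open>N\<close>.\<close>
  have "lp_halfspace p c v \<inter> P = {z \<in> P. v \<notin> improving N (c - z)}" for c v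
  proof -
    have "c - \<epsilon> *\<^sub>R v - z = c - z - \<epsilon> *\<^sub>R v" for \<epsilon> z by simp
    then show ?thesis by (auto simp only: lp_halfspace_def improving_def N(3) not_less Int_iff mem_Collect_eq)
  qed
  then show ?thesis
    using centerpoint_coercive_convex[OF N(1,2) assms(2)] by auto
qed

end
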